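(* Suppose that $X$ and $Y$ are connected CW complexes whose homology groups are finitely generated in each dimension. Then $$\nu_n(X\times Y)\geq \nu_n(X)+\nu_n(Y)-1.$$
   Context: For a space $X$, $C(X)$ is the algebra of continuous complex-valued functions on $X$, and $\mathrm{M}(n,C(X))$ is the ring of $n\times n$ matrices over $C(X)$; $A^*$ denotes the pointwise conjugate transpose, and $A$ is normal if $AA^*=A^*A$. Characteristic polynomials are taken to be monic. A monic polynomial $\mu\in C(X)[\lambda]$ of degree $n$ splits over $C(X)$ if $\mu(\lambda)=\prod_{i=1}^n(\lambda-\lambda_i)$ for some $\lambda_1,\dots,\lambda_n\in C(X)$; it is multiplicity-free if for each $x\in X$ the polynomial over $\mathbb{C}$ obtained by evaluating the coefficients at $x$ has $n$ distinct roots. Matrices $A,B\in\mathrm{M}(n,C(X))$ are unitarily equivalent if $B=U^*AU$ for some $U\in\mathrm{M}(n,C(X))$ with $U^*U=UU^*=I$. For a connected CW complex $X$, $\nu_n(X)$ denotes the number (cardinality) of unitary equivalence classes of normal matrices in $\mathrm{M}(n,C(X))$ with a given characteristic polynomial $\mu$ of degree $n$ that is multiplicity-free and splits over $C(X)$; this number does not depend on the choice of such $\mu$. (For an infinite cardinal $\kappa$, $\kappa-1$ means $\kappa$.) Homology is with integer coefficients. *)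

theory Defs
  imports
    "HOL-Homology.Homology"
    "Jordan_Normal_Form.Char_Poly"
    "Jordan_Normal_Form.Schur_Decomposition"
begin

unbundle cardinal_syntax

text \<open>
  CW complexes in the sense of Whitehead: a Hausdorff space with a partition \<open>E\<close> into cells, a
  dimension \<open>d e\<close> and a characteristic map \<open>\<Phi> e\<close> for every cell \<open>e\<close>, subject to closure
  finiteness and the weak topology. Cells have no index set of their own: they are the subsets
  \<open>e \<in> E\<close> themselves.
\<close>

definition sqnorm :: "nat \<Rightarrow> (nat \<Rightarrow> real) \<Rightarrow> real" where
  "sqnorm k v = (\<Sum>i<k. (v i)\<^sup>2)"

definition closed_disk :: "nat \<Rightarrow> (nat \<Rightarrow> real) topology" where
  "closed_disk k = subtopology (Euclidean_space k) {v. sqnorm k v \<le> 1}"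

definition open_disk :: "nat \<Rightarrow> (nat \<Rightarrow> real) topology" where
  "open_disk k = subtopology (Euclidean_space k) {v. sqnorm k v < 1}"

definition CW_decomposition ::
  "'a topology \<Rightarrow> 'a set set \<Rightarrow> ('a set \<Rightarrow> nat) \<Rightarrow> ('a set \<Rightarrow> (nat \<Rightarrow> real) \<Rightarrow> 'a) \<Rightarrow> bool" where
  "CW_decomposition X E d \<Phi> \<longleftrightarrow>
     Hausdorff_space X \<and>
     \<Union>E = topspace X \<and> disjoint E \<and>
     (\<forall>e\<in>E.
        continuous_map (closed_disk (d e)) X (\<Phi> e) \<and>
        homeomorphic_map (open_disk (d e)) (subtopology X e) (\<Phi> e) \<and>
        (\<exists>F. finite F \<and> F \<subseteq> {e'\<in>E. d e' < d e} \<and>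
             \<Phi> e ` (topspace (closed_disk (d e)) - topspace (open_disk (d e))) \<subseteq> \<Union>F)) \<and>
     (\<forall>C. C \<subseteq> topspace X \<longrightarrow>
        (closedin X C \<longleftrightarrow> (\<forall>e\<in>E. closedin X (C \<inter> X closure_of e))))"

definition CW_complex :: "'a topology \<Rightarrow> bool" where
  "CW_complex X \<longleftrightarrow> (\<exists>E d \<Phi>. CW_decomposition X E d \<Phi>)"

text \<open>
  \<^const>\<open>connected_space\<close> admits the empty space, which is not connected in the convention used here.
\<close>

definition connected_CW_complex :: "'a topology \<Rightarrow> bool" where
  "connected_CW_complex X \<longleftrightarrow> CW_complex X \<and> connected_space X \<and> topspace X \<noteq> {}"

definition finitely_generated_group :: "('a, 'b) monoid_scheme \<Rightarrow> bool" where
  "finitely_generated_group G \<longleftrightarrow>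
     (\<exists>S. finite S \<and> S \<subseteq> carrier G \<and> generate G S = carrier G)"

text \<open>
  Elements of \<open>C(X)\<close>, \<open>C(X)[\<lambda>]\<close> and \<open>M(n,C(X))\<close> are represented by functions of the point
  \<open>x\<close>. Only their values on \<^term>\<open>topspace X\<close> matter: everything below, the relation of unitary
  equivalence included, ignores values outside.
\<close>

definition cont_fun :: "'a topology \<Rightarrow> ('a \<Rightarrow> complex) set" where
  "cont_fun X = {f. continuous_map X euclidean f}"

definition cont_mat :: "nat \<Rightarrow> 'a topology \<Rightarrow> ('a \<Rightarrow> complex mat) set" where
  "cont_mat n X =
     {A. (\<forall>x\<in>topspace X. A x \<in> carrier_mat n n) \<and>
         (\<forall>i<n. \<forall>j<n. (\<lambda>x. A x $$ (i, j)) \<in> cont_fun X)}"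

definition normal_mat :: "nat \<Rightarrow> 'a topology \<Rightarrow> ('a \<Rightarrow> complex mat) set" where
  "normal_mat n X =
     {A \<in> cont_mat n X. \<forall>x\<in>topspace X. A x * mat_adjoint (A x) = mat_adjoint (A x) * A x}"

definition unitary_mat :: "nat \<Rightarrow> 'a topology \<Rightarrow> ('a \<Rightarrow> complex mat) set" where
  "unitary_mat n X =
     {U \<in> cont_mat n X. \<forall>x\<in>topspace X.
        mat_adjoint (U x) * U x = 1\<^sub>m n \<and> U x * mat_adjoint (U x) = 1\<^sub>m n}"

definition monic_poly :: "nat \<Rightarrow> 'a topology \<Rightarrow> ('a \<Rightarrow> complex poly) set" where
  "monic_poly n X =
     {\<mu>. (\<forall>k. (\<lambda>x. coeff (\<mu> x) k) \<in> cont_fun X) \<and>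
         (\<forall>x\<in>topspace X. degree (\<mu> x) = n \<and> lead_coeff (\<mu> x) = 1)}"

definition splits_over :: "nat \<Rightarrow> 'a topology \<Rightarrow> ('a \<Rightarrow> complex poly) \<Rightarrow> bool" where
  "splits_over n X \<mu> \<longleftrightarrow>
     (\<exists>l. (\<forall>i<n. l i \<in> cont_fun X) \<and> (\<forall>x\<in>topspace X. \<mu> x = (\<Prod>i<n. [:- l i x, 1:])))"

definition multiplicity_free :: "nat \<Rightarrow> 'a topology \<Rightarrow> ('a \<Rightarrow> complex poly) \<Rightarrow> bool" where
  "multiplicity_free n X \<mu> \<longleftrightarrow> (\<forall>x\<in>topspace X. card {z. poly (\<mu> x) z = 0} = n)"

definition admissible_poly :: "nat \<Rightarrow> 'a topology \<Rightarrow> ('a \<Rightarrow> complex poly) \<Rightarrow> bool" where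
  "admissible_poly n X \<mu> \<longleftrightarrow>
     \<mu> \<in> monic_poly n X \<and> multiplicity_free n X \<mu> \<and> splits_over n X \<mu>"

definition unitary_equiv ::
  "nat \<Rightarrow> 'a topology \<Rightarrow> (('a \<Rightarrow> complex mat) \<times> ('a \<Rightarrow> complex mat)) set" where
  "unitary_equiv n X =
     {(A, B). A \<in> cont_mat n X \<and> B \<in> cont_mat n X \<and>
        (\<exists>U\<in>unitary_mat n X. \<forall>x\<in>topspace X. B x = mat_adjoint (U x) * A x * U x)}"

text \<open>
  \<open>nu n X \<mu>\<close> is a cardinal in the sense of the BNF cardinal library (a cardinal well-order).
  For admissible \<open>\<mu>\<close> it is the number \<open>\<nu>\<^sub>n(X)\<close>, which does not depend on \<open>\<mu>\<close>; since that
  independence is a theorem, \<open>\<mu>\<close> stays a parameter.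
\<close>

definition nu :: "nat \<Rightarrow> 'a topology \<Rightarrow> ('a \<Rightarrow> complex poly) \<Rightarrow> ('a \<Rightarrow> complex mat) set rel" where
  "nu n X \<mu> =
     |{A \<in> normal_mat n X. \<forall>x\<in>topspace X. char_poly (A x) = \<mu> x} // unitary_equiv n X|"

text \<open>The cardinal \<open>\<kappa> - 1\<close>, which is \<open>\<kappa>\<close> for infinite \<open>\<kappa>\<close>.\<close>

definition cminus1 :: "'b rel \<Rightarrow> 'b rel" where
  "cminus1 r = (if finite (Field r) then |Field r - {SOME a. a \<in> Field r}| else r)"

end

theory Submission
  imports Defs
begin

text \<open>
  The idea is to compare classes over \<open>X\<close> and over \<open>Y\<close> with classes over \<open>X \<times> Y\<close> by pulling back
  along the two projections, and to recover them by restricting to the slices \<open>X \<times> {y0}\<close> and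
  \<open>{x0} \<times> Y\<close>.

  A pullback of a family over \<open>X\<close> has the eigenvalues of the family, not the roots of the polynomial
  \<open>\<rho>\<close> prescribed over \<open>X \<times> Y\<close>. This is repaired by a functional calculus: when the eigenvalues
  \<open>l i\<close> are distinct, the polynomial that interpolates \<open>l i \<mapsto> r i\<close> replaces the eigenvalues of a normal
  matrix by the \<open>r i\<close> and keeps its eigenvectors. Its coefficients depend continuously on the \<open>l i\<close>
  and \<open>r i\<close>, so continuous families go to continuous families. Combining a pullback along \<open>\<pi>\<close> with
  this change of eigenvalues gives the operation \<open>transfer\<close>. It respects unitary equivalence
  (\<open>transfer_unitary_equiv\<close>), is functorial in \<open>\<pi>\<close> (\<open>transfer_transfer\<close>, \<open>transfer_id\<close>), and along a
  constant map it always gives the class of the diagonal matrix (\<open>transfer_const\<close>), because a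
  single normal matrix can be diagonalised by a unitary one.

  Since each projection has a section, functoriality makes both maps on classes injective. If a class
  over \<open>X \<times> Y\<close> comes from \<open>A\<close> over \<open>X\<close> and from \<open>B\<close> over \<open>Y\<close>, then restricting to \<open>{x0} \<times> Y\<close> gives
  back the class of \<open>B\<close> on the one hand, and the transfer of \<open>A\<close> along a constant map on the other; so
  \<open>B\<close> lies in the class of the diagonal matrix. Thus the two images share at most one class, which
  accounts for the \<open>-1\<close>; \<open>cminus1_csum_le\<close> turns this into the inequality of cardinals.
\<close>

section \<open>Unitary diagonalisation of normal matrices with simple spectrum\<close>

definition unitary :: "nat \<Rightarrow> complex mat \<Rightarrow> bool" where
  "unitary n W \<longleftrightarrow>
     W \<in> carrier_mat n n \<and> mat_adjoint W * W = 1\<^sub>m n \<and> W * mat_adjoint W = 1\<^sub>m n"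

text \<open>
  For unitary \<open>W\<close>, the normal matrix with eigenvalues \<open>d 0, \<dots>, d (n - 1)\<close> in the orthonormal basis
  formed by the columns of \<open>W\<close>. In this form sums, products and adjoints are computed on the eigenvalues alone.
\<close>

definition udiag :: "nat \<Rightarrow> complex mat \<Rightarrow> (nat \<Rightarrow> complex) \<Rightarrow> complex mat" where
  "udiag n W d = W * mat_diag n d * mat_adjoint W"

lemma mat_adjoint_carrier [simp, intro]:
  "A \<in> carrier_mat m n \<Longrightarrow> mat_adjoint A \<in> carrier_mat n m"
  unfolding mat_adjoint_def by (auto intro!: carrier_matI)

lemma mat_adjoint_index:
  fixes A :: "complex mat"
  assumes "i < dim_col A" "j < dim_row A"
  shows "mat_adjoint A $$ (i, j) = cnj (A $$ (j, i))"
  using assms unfolding mat_adjoint_def by (simp add: mat_of_rows_index)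

lemma dim_mat_adjoint [simp]:
  "dim_row (mat_adjoint A) = dim_col A" "dim_col (mat_adjoint A) = dim_row A"
  unfolding mat_adjoint_def by auto

lemma mat_adjoint_mat_adjoint [simp]: "mat_adjoint (mat_adjoint A) = (A :: complex mat)"
  by (rule eq_matI) (auto simp: mat_adjoint_index)

lemma mat_adjoint_mult:
  fixes A B :: "complex mat"
  assumes "A \<in> carrier_mat m k" "B \<in> carrier_mat k n"
  shows "mat_adjoint (A * B) = mat_adjoint B * mat_adjoint A"
  using assms
  by (intro eq_matI) (auto simp: mat_adjoint_index scalar_prod_def intro!: sum.cong)

lemma mat_adjoint_one [simp]: "mat_adjoint (1\<^sub>m n) = (1\<^sub>m n :: complex mat)"
  by (rule eq_matI) (auto simp: mat_adjoint_index)

text \<open>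
  The general laws have inner dimensions that rewriting cannot infer; with all dimensions equal they
  become usable as rewrite rules.
\<close>

lemmas square_mat_simps = assoc_mult_mat[of _ n n _ n _ n] mult_carrier_mat[of _ n n _ n]
  left_mult_one_mat[of _ n n] right_mult_one_mat[of _ n n] mat_adjoint_mult[of _ n n _ n] for n

lemma unitary_carrier: "unitary n W \<Longrightarrow> W \<in> carrier_mat n n"
  by (simp add: unitary_def)

lemma unitary_one: "unitary n (1\<^sub>m n)"
  by (simp add: unitary_def)

lemma unitary_adjoint: "unitary n W \<Longrightarrow> unitary n (mat_adjoint W)"
  by (auto simp: unitary_def)

lemma unitary_mult:
  assumes "unitary n V" "unitary n W"
  shows "unitary n (V * W)"
proof -
  have VW: "V \<in> carrier_mat n n" "W \<in> carrier_mat n n"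
    using assms by (auto simp: unitary_def)
  note [simp] = VW VW[THEN mat_adjoint_carrier]
  have "mat_adjoint W * (mat_adjoint V * (V * W)) = mat_adjoint W * ((mat_adjoint V * V) * W)"
    by (simp add: square_mat_simps[where n = n])
  also have "\<dots> = 1\<^sub>m n"
    using assms by (simp add: unitary_def square_mat_simps[where n = n])
  finally have 1: "mat_adjoint W * (mat_adjoint V * (V * W)) = 1\<^sub>m n" .
  have "V * (W * (mat_adjoint W * mat_adjoint V)) = V * ((W * mat_adjoint W) * mat_adjoint V)"
    by (simp add: square_mat_simps[where n = n])
  also have "\<dots> = 1\<^sub>m n"
    using assms by (simp add: unitary_def square_mat_simps[where n = n])
  finally have 2: "V * (W * (mat_adjoint W * mat_adjoint V)) = 1\<^sub>m n" .
  show ?thesis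
    using 1 2 by (simp add: unitary_def square_mat_simps[where n = n])
qed

lemma udiag_carrier [simp]: "W \<in> carrier_mat n n \<Longrightarrow> udiag n W d \<in> carrier_mat n n"
  by (auto simp: udiag_def)

lemma dim_udiag [simp]: "dim_row (udiag n W d) = dim_row W" "dim_col (udiag n W d) = dim_row W"
  by (simp_all add: udiag_def)

lemma udiag_index:
  assumes "W \<in> carrier_mat n n" "i < n" "j < n"
  shows "udiag n W d $$ (i, j) = (\<Sum>k<n. W $$ (i, k) * d k * cnj (W $$ (j, k)))"
  using assms
  by (simp add: udiag_def mat_diag_mult_right[of _ n] scalar_prod_def mat_adjoint_index
      lessThan_atLeast0)

lemma udiag_cong: "(\<And>k. k < n \<Longrightarrow> d k = e k) \<Longrightarrow> udiag n W d = udiag n W e"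
proof -
  assume "\<And>k. k < n \<Longrightarrow> d k = e k"
  hence "mat_diag n d = mat_diag n e" by (auto simp: mat_diag_def intro!: eq_matI)
  thus ?thesis by (simp add: udiag_def)
qed

lemma udiag_add:
  assumes "W \<in> carrier_mat n n"
  shows "udiag n W d + udiag n W e = udiag n W (\<lambda>k. d k + e k)"
  using assms
  by (intro eq_matI) (simp_all add: udiag_index distrib_left distrib_right sum.distrib)

lemma udiag_smult:
  assumes "W \<in> carrier_mat n n"
  shows "c \<cdot>\<^sub>m udiag n W d = udiag n W (\<lambda>k. c * d k)"
  using assms
  by (intro eq_matI) (simp_all add: udiag_index sum_distrib_left mult_ac)

lemma udiag_adjoint:
  assumes "W \<in> carrier_mat n n"
  shows "mat_adjoint (udiag n W d) = udiag n W (\<lambda>k. cnj (d k))"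
  using assms
  by (intro eq_matI) (simp_all add: udiag_index mat_adjoint_index mult_ac)

lemma udiag_zero: "W \<in> carrier_mat n n \<Longrightarrow> udiag n W (\<lambda>_. 0) = 0\<^sub>m n n"
  using udiag_carrier[of W n "\<lambda>_. 0"] by (intro eq_matI) (auto simp: udiag_index)

lemma udiag_one: "unitary n W \<Longrightarrow> udiag n W (\<lambda>_. 1) = 1\<^sub>m n"
  by (simp add: udiag_def unitary_def square_mat_simps[where n = n])

lemma udiag_mult:
  assumes "unitary n W"
  shows "udiag n W d * udiag n W e = udiag n W (\<lambda>k. d k * e k)"
proof -
  have W: "W \<in> carrier_mat n n" using assms by (rule unitary_carrier)
  note [simp] = W W[THEN mat_adjoint_carrier]
  have "udiag n W d * udiag n W e =
        W * mat_diag n d * ((mat_adjoint W * W) * (mat_diag n e * mat_adjoint W))"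
    by (simp add: udiag_def square_mat_simps[where n = n])
  also have "\<dots> = W * (mat_diag n d * mat_diag n e) * mat_adjoint W"
    using assms by (simp add: unitary_def square_mat_simps[where n = n] del: mat_diag_diag)
  finally show ?thesis by (simp add: udiag_def)
qed

lemma udiag_conj:
  assumes "W \<in> carrier_mat n n" "U \<in> carrier_mat n n"
  shows "mat_adjoint U * udiag n W d * U = udiag n (mat_adjoint U * W) d"
proof -
  note [simp] = assms assms[THEN mat_adjoint_carrier]
  show ?thesis
    by (simp add: udiag_def square_mat_simps[where n = n])
qed

lemma udiag_normal:
  "unitary n W \<Longrightarrow>
    udiag n W d * mat_adjoint (udiag n W d) = mat_adjoint (udiag n W d) * udiag n W d"
  by (simp add: udiag_adjoint unitary_carrier udiag_mult mult.commute)

lemma char_poly_udiag: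
  assumes "unitary n W"
  shows "char_poly (udiag n W d) = (\<Prod>k<n. [:- d k, 1:])"
proof -
  have "similar_mat_wit (udiag n W d) (mat_diag n d) W (mat_adjoint W)"
    by (rule similar_mat_witI[of _ _ n]) (use assms in \<open>auto simp: unitary_def udiag_def\<close>)
  hence "char_poly (udiag n W d) = char_poly (mat_diag n d)"
    by (intro char_poly_similar) (auto simp: similar_mat_def)
  also have "\<dots> = (\<Prod>a\<leftarrow>diag_mat (mat_diag n d). [:- a, 1:])"
    by (rule char_poly_upper_triangular[of _ n]) (auto simp: mat_diag_def upper_triangular_def)
  also have "\<dots> = (\<Prod>k<n. [:- d k, 1:])"
    by (simp add: diag_mat_def mat_diag_def prod.list_conv_set_nth lessThan_atLeast0)
  finally show ?thesis .
qed

lemma cscalar_prod_mult_mat_vec: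
  fixes A :: "complex mat"
  assumes "A \<in> carrier_mat n n" "v \<in> carrier_vec n" "w \<in> carrier_vec n"
  shows "(A *\<^sub>v v) \<bullet>c w = v \<bullet>c (mat_adjoint A *\<^sub>v w)"
proof -
  have "(A *\<^sub>v v) \<bullet>c w = (\<Sum>i<n. \<Sum>j<n. A $$ (i, j) * v $ j * cnj (w $ i))"
    using assms by (simp add: scalar_prod_def sum_distrib_right lessThan_atLeast0)
  also have "\<dots> = (\<Sum>j<n. \<Sum>i<n. A $$ (i, j) * v $ j * cnj (w $ i))"
    by (rule sum.swap)
  also have "\<dots> = v \<bullet>c (mat_adjoint A *\<^sub>v w)"
    using assms
    by (auto simp: scalar_prod_def sum_distrib_left mat_adjoint_index lessThan_atLeast0
        mult_ac intro!: sum.cong)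
  finally show ?thesis .
qed

text \<open>
  For normal \<open>A\<close> the vectors \<open>A v\<close> and \<open>A\<^sup>* v\<close> have the same norm. Hence all terms in the expansion of
  the squared norm of \<open>A\<^sup>* v - cnj k v\<close> are multiples of \<open>\<bar>k\<bar>\<^sup>2\<close> times the squared norm of \<open>v\<close>, and they
  cancel.
\<close>

lemma normal_eigenvector_adjoint:
  fixes A :: "complex mat"
  assumes A: "A \<in> carrier_mat n n" and normal: "A * mat_adjoint A = mat_adjoint A * A"
    and v: "v \<in> carrier_vec n" and eig: "A *\<^sub>v v = k \<cdot>\<^sub>v v"
  shows "mat_adjoint A *\<^sub>v v = cnj k \<cdot>\<^sub>v v"
proof -
  let ?u = "mat_adjoint A *\<^sub>v v" and ?c = "cnj k"
  have A': "mat_adjoint A \<in> carrier_mat n n" using A by simp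
  have u: "?u \<in> carrier_vec n" using A' v by auto
  have uu: "?u \<bullet>c ?u = k * cnj k * (v \<bullet>c v)"
  proof -
    have "?u \<bullet>c ?u = v \<bullet>c ((A * mat_adjoint A) *\<^sub>v v)"
      using cscalar_prod_mult_mat_vec[OF A' v u] assoc_mult_mat_vec[OF A A' v] by simp
    also have "\<dots> = v \<bullet>c (mat_adjoint A *\<^sub>v (A *\<^sub>v v))"
      unfolding normal using assoc_mult_mat_vec[OF A' A v] by simp
    also have "\<dots> = (A *\<^sub>v v) \<bullet>c (A *\<^sub>v v)"
      using cscalar_prod_mult_mat_vec[OF A v, of "A *\<^sub>v v"] A v by simp
    finally show ?thesis using v unfolding eig by (simp add: conjugate_smult_vec)
  qed
  have uv: "?u \<bullet>c v = cnj k * (v \<bullet>c v)"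
    using cscalar_prod_mult_mat_vec[OF A' v v] v by (simp add: eig conjugate_smult_vec)
  have vu: "v \<bullet>c ?u = k * (v \<bullet>c v)"
    using cscalar_prod_mult_mat_vec[OF A v v] v by (simp add: eig)
  have "(?u + (- ?c) \<cdot>\<^sub>v v) \<bullet>c (?u + (- ?c) \<cdot>\<^sub>v v) = 0"
    using u v uu uv vu
    by (simp add: conjugate_add_vec[of _ n] conjugate_smult_vec add_scalar_prod_distrib[of _ n]
        scalar_prod_add_distrib[of _ n])
  hence *: "?u + (- ?c) \<cdot>\<^sub>v v = 0\<^sub>v n"
    using conjugate_square_eq_0_vec[of "?u + (- ?c) \<cdot>\<^sub>v v" n] u v by simp
  show ?thesis
  proof (rule eq_vecI)
    fix i assume i: "i < dim_vec (?c \<cdot>\<^sub>v v)"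
    hence "(?u + (- ?c) \<cdot>\<^sub>v v) $ i = 0" using * v by simp
    thus "?u $ i = (?c \<cdot>\<^sub>v v) $ i" using i u v A by simp
  qed (use u v A in auto)
qed

lemma normal_eigenvectors_orthogonal:
  fixes A :: "complex mat"
  assumes A: "A \<in> carrier_mat n n" and normal: "A * mat_adjoint A = mat_adjoint A * A"
    and v: "v \<in> carrier_vec n" "A *\<^sub>v v = k \<cdot>\<^sub>v v"
    and w: "w \<in> carrier_vec n" "A *\<^sub>v w = m \<cdot>\<^sub>v w"
    and "k \<noteq> m"
  shows "v \<bullet>c w = 0"
proof -
  have "k * (v \<bullet>c w) = (A *\<^sub>v v) \<bullet>c w" using v w by simp
  also have "\<dots> = v \<bullet>c (mat_adjoint A *\<^sub>v w)"
    by (rule cscalar_prod_mult_mat_vec[OF A v(1) w(1)])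
  also have "\<dots> = m * (v \<bullet>c w)"
    using v w by (simp add: normal_eigenvector_adjoint[OF A normal w] conjugate_smult_vec)
  finally show ?thesis using \<open>k \<noteq> m\<close> by simp
qed

lemma eigenvector_normalized:
  fixes A :: "complex mat"
  assumes A: "A \<in> carrier_mat n n" and "poly (char_poly A) k = 0"
  obtains v where "v \<in> carrier_vec n" "A *\<^sub>v v = k \<cdot>\<^sub>v v" "v \<bullet>c v = 1"
proof -
  obtain v where v: "v \<in> carrier_vec n" "v \<noteq> 0\<^sub>v n" "A *\<^sub>v v = k \<cdot>\<^sub>v v"
    using assms eigenvalue_root_char_poly[OF A, of k] A
    by (auto simp: eigenvalue_def eigenvector_def)
  have "v \<bullet>c v = (\<Sum>i<n. v $ i * cnj (v $ i))"
    using v by (simp add: scalar_prod_def lessThan_atLeast0)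
  also have "\<dots> = complex_of_real (\<Sum>i<n. (cmod (v $ i))\<^sup>2)"
    by (simp only: of_real_sum complex_norm_square)
  finally have vv: "v \<bullet>c v = complex_of_real (\<Sum>i<n. (cmod (v $ i))\<^sup>2)" (is "_ = of_real ?s") .
  have "?s \<ge> 0" by (simp add: sum_nonneg)
  moreover have "?s \<noteq> 0"
  proof
    assume "?s = 0"
    hence "v \<bullet>c v = 0" unfolding vv by simp
    thus False using v conjugate_square_eq_0_vec[of v n] by simp
  qed
  ultimately have s: "?s > 0" by simp
  let ?c = "complex_of_real (1 / sqrt ?s)"
  have "?c * ?c * of_real ?s = 1"
    unfolding of_real_mult[symmetric] using s by simp
  hence "(?c \<cdot>\<^sub>v v) \<bullet>c (?c \<cdot>\<^sub>v v) = 1"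
    using v vv by (simp add: conjugate_smult_vec mult.assoc)
  moreover have "A *\<^sub>v (?c \<cdot>\<^sub>v v) = k \<cdot>\<^sub>v (?c \<cdot>\<^sub>v v)"
    using v A by (simp add: mult_mat_vec[OF A v(1)] smult_smult_assoc mult.commute)
  ultimately show ?thesis using that[of "?c \<cdot>\<^sub>v v"] v by simp
qed

text \<open>
  The roots \<open>l k\<close> are distinct, so one unit eigenvector for each of them gives \<open>n\<close> orthonormal
  vectors, the columns of \<open>W\<close>. The eigenvalues appear in the order of \<open>l\<close>; this is what later allows
  them to be replaced one by one.
\<close>

lemma normal_unitarily_diagonalizable:
  fixes A :: "complex mat"
  assumes A: "A \<in> carrier_mat n n" and normal: "A * mat_adjoint A = mat_adjoint A * A"
    and cp: "char_poly A = (\<Prod>k<n. [:- l k, 1:])" and inj: "inj_on l {..<n}"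
  obtains W where "unitary n W" "A = udiag n W l"
proof -
  have "\<exists>v. v \<in> carrier_vec n \<and> A *\<^sub>v v = l k \<cdot>\<^sub>v v \<and> v \<bullet>c v = 1" if "k < n" for k
  proof -
    have "poly (char_poly A) (l k) = 0"
      using that by (auto simp: cp poly_prod)
    thus ?thesis using eigenvector_normalized[OF A] by metis
  qed
  then obtain v where v: "\<And>k. k < n \<Longrightarrow> v k \<in> carrier_vec n"
    "\<And>k. k < n \<Longrightarrow> A *\<^sub>v v k = l k \<cdot>\<^sub>v v k" "\<And>k. k < n \<Longrightarrow> v k \<bullet>c v k = 1"
    by metis
  define W where "W = Matrix.mat n n (\<lambda>(i, k). v k $ i)"
  have W: "W \<in> carrier_mat n n" by (simp add: W_def)
  have col: "col W k = v k" if "k < n" for k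
    using that v(1)[OF that] by (auto simp: W_def intro!: eq_vecI)
  have WW: "mat_adjoint W * W = 1\<^sub>m n"
  proof (rule eq_matI)
    fix i j assume "i < dim_row (1\<^sub>m n :: complex mat)" "j < dim_col (1\<^sub>m n :: complex mat)"
    hence ij: "i < n" "j < n" by auto
    have "(mat_adjoint W * W) $$ (i, j) = (\<Sum>k<n. cnj (v i $ k) * v j $ k)"
      using ij W by (simp add: scalar_prod_def mat_adjoint_index lessThan_atLeast0 W_def)
    also have "\<dots> = v j \<bullet>c v i"
      using v(1)[OF ij(1)] v(1)[OF ij(2)] by (simp add: scalar_prod_def mult.commute lessThan_atLeast0)
    also have "\<dots> = (if i = j then 1 else 0)"
    proof (cases "i = j")
      case False
      hence "l j \<noteq> l i" using inj ij by (auto simp: inj_on_def)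
      thus ?thesis
        using False normal_eigenvectors_orthogonal[OF A normal, of "v j" "l j" "v i" "l i"] v ij
        by simp
    qed (use v ij in simp)
    finally show "(mat_adjoint W * W) $$ (i, j) = 1\<^sub>m n $$ (i, j)" using ij by simp
  qed (use W in auto)
  hence WW': "W * mat_adjoint W = 1\<^sub>m n"
    using mat_mult_left_right_inverse[OF mat_adjoint_carrier[OF W] W] by simp
  have "A * W = W * mat_diag n l"
  proof (rule eq_matI)
    fix i j assume "i < dim_row (W * mat_diag n l)" "j < dim_col (W * mat_diag n l)"
    hence ij: "i < n" "j < n" using W by (auto simp: mat_diag_def)
    have "(A * W) $$ (i, j) = (A *\<^sub>v v j) $ i"
      using ij A W by (simp add: col)
    also have "\<dots> = (W * mat_diag n l) $$ (i, j)"
      using ij v[of j] W by (simp add: mat_diag_mult_right[of _ n] W_def)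
    finally show "(A * W) $$ (i, j) = (W * mat_diag n l) $$ (i, j)" .
  qed (use A W in \<open>auto simp: mat_diag_def\<close>)
  hence "udiag n W l = A * W * mat_adjoint W"
    by (simp add: udiag_def)
  hence "udiag n W l = A * (W * mat_adjoint W)"
    using assoc_mult_mat[OF A W mat_adjoint_carrier[OF W]] by simp
  hence "A = udiag n W l" using WW' A by simp
  thus ?thesis using that[of W] W WW WW' by (simp add: unitary_def)
qed

section \<open>Moving the eigenvalues by Lagrange interpolation\<close>

text \<open>
  The \<open>i\<close>-th Lagrange basis polynomial for the nodes \<open>l\<close>, evaluated at the matrix \<open>A\<close>, with factors
  only for the nodes below the last argument. With all \<open>n\<close> factors it is the spectral projection of
  \<open>A\<close> for the eigenvalue \<open>l i\<close>. The recursion spells out matrix operations that visibly preserve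
  continuity in \<open>A\<close> and \<open>l\<close>.
\<close>

primrec lagrange_prod ::
  "nat \<Rightarrow> (nat \<Rightarrow> complex) \<Rightarrow> complex mat \<Rightarrow> nat \<Rightarrow> nat \<Rightarrow> complex mat" where
  "lagrange_prod n l A i 0 = 1\<^sub>m n"
| "lagrange_prod n l A i (Suc k) = lagrange_prod n l A i k *
     (if k = i then 1\<^sub>m n else inverse (l i - l k) \<cdot>\<^sub>m (A + (- l k) \<cdot>\<^sub>m 1\<^sub>m n))"

primrec lagrange_sum ::
  "nat \<Rightarrow> (nat \<Rightarrow> complex) \<Rightarrow> (nat \<Rightarrow> complex) \<Rightarrow> complex mat \<Rightarrow> nat \<Rightarrow> complex mat" where
  "lagrange_sum n l r A 0 = 0\<^sub>m n n"
| "lagrange_sum n l r A (Suc k) = lagrange_sum n l r A k + r k \<cdot>\<^sub>m lagrange_prod n l A k n"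

definition lagrange_calc ::
  "nat \<Rightarrow> (nat \<Rightarrow> complex) \<Rightarrow> (nat \<Rightarrow> complex) \<Rightarrow> complex mat \<Rightarrow> complex mat" where
  "lagrange_calc n l r A = lagrange_sum n l r A n"

lemma lagrange_prod_udiag:
  assumes W: "unitary n W"
  shows "lagrange_prod n l (udiag n W d) i m =
    udiag n W (\<lambda>a. \<Prod>k<m. if k = i then 1 else (d a - l k) / (l i - l k))"
proof (induction m)
  case 0
  show ?case using udiag_one[OF W] by simp
next
  case (Suc m)
  have "(if m = i then 1\<^sub>m n
         else inverse (l i - l m) \<cdot>\<^sub>m (udiag n W d + (- l m) \<cdot>\<^sub>m 1\<^sub>m n)) =
        udiag n W (\<lambda>a. if m = i then 1 else (d a - l m) / (l i - l m))"
    unfolding udiag_one[OF W, symmetric] using W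
    by (auto simp: udiag_smult udiag_add unitary_carrier field_simps intro!: udiag_cong)
  with Suc show ?case by (simp add: udiag_mult[OF W])
qed

text \<open>
  The spectral projection for \<open>l i\<close> is diagonal with a single entry \<open>1\<close> in the basis \<open>W\<close>, since the
  Lagrange basis polynomial is \<open>1\<close> at \<open>l i\<close> and vanishes at the other nodes. The point is that
  \<open>lagrange_calc\<close> is computed from the matrix and not from \<open>W\<close>: it stays continuous on families
  whose eigenbases \<open>W\<close> cannot be chosen continuously.
\<close>

lemma lagrange_calc_udiag:
  assumes W: "unitary n W" and inj: "inj_on l {..<n}"
  shows "lagrange_calc n l r (udiag n W l) = udiag n W r"
proof -
  have proj: "lagrange_prod n l (udiag n W l) i n = udiag n W (\<lambda>a. if a = i then 1 else 0)"
    if i: "i < n" for i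
    unfolding lagrange_prod_udiag[OF W]
  proof (rule udiag_cong)
    fix a assume a: "a < n"
    show "(\<Prod>k<n. if k = i then 1 else (l a - l k) / (l i - l k)) = (if a = i then 1 else 0)"
    proof (cases "a = i")
      case True
      have "l i - l k \<noteq> 0" if "k < n" "k \<noteq> i" for k
        using inj that i by (auto simp: inj_on_def)
      thus ?thesis using True by (auto intro!: prod.neutral)
    next
      case False
      thus ?thesis using a by (auto intro!: bexI[of _ a])
    qed
  qed
  have "lagrange_sum n l r (udiag n W l) m = udiag n W (\<lambda>a. \<Sum>i<m. r i * (if a = i then 1 else 0))"
    if "m \<le> n" for m
    using that
  proof (induction m)
    case 0
    thus ?case using W by (simp add: udiag_zero unitary_carrier)
  next
    case (Suc m)
    thus ?case using W
      by (simp add: proj udiag_smult udiag_add unitary_carrier del: mult_zero_right)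
  qed
  hence "lagrange_calc n l r (udiag n W l) =
         udiag n W (\<lambda>a. \<Sum>i<n. r i * (if a = i then 1 else 0))"
    by (simp add: lagrange_calc_def)
  also have "\<dots> = udiag n W r"
    by (rule udiag_cong) (simp add: if_distrib sum.delta cong: if_cong)
  finally show ?thesis .
qed


section \<open>Continuous families of matrices\<close>

lemma cont_fun_const: "(\<lambda>_. c) \<in> cont_fun X"
  by (simp add: cont_fun_def)

lemma cont_fun_mult: "f \<in> cont_fun X \<Longrightarrow> g \<in> cont_fun X \<Longrightarrow> (\<lambda>x. f x * g x) \<in> cont_fun X"
  by (simp add: cont_fun_def continuous_map_atin tendsto_mult)

lemma cont_fun_add: "f \<in> cont_fun X \<Longrightarrow> g \<in> cont_fun X \<Longrightarrow> (\<lambda>x. f x + g x) \<in> cont_fun X"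
  by (simp add: cont_fun_def continuous_map_add)

lemma cont_fun_diff: "f \<in> cont_fun X \<Longrightarrow> g \<in> cont_fun X \<Longrightarrow> (\<lambda>x. f x - g x) \<in> cont_fun X"
  by (simp add: cont_fun_def continuous_map_diff)

lemma cont_fun_minus: "f \<in> cont_fun X \<Longrightarrow> (\<lambda>x. - f x) \<in> cont_fun X"
  by (simp add: cont_fun_def)

lemma cont_fun_cnj: "f \<in> cont_fun X \<Longrightarrow> (\<lambda>x. cnj (f x)) \<in> cont_fun X"
  by (simp add: cont_fun_def continuous_map_atin tendsto_cnj)

lemma cont_fun_inverse:
  "f \<in> cont_fun X \<Longrightarrow> (\<And>x. x \<in> topspace X \<Longrightarrow> f x \<noteq> 0) \<Longrightarrow> (\<lambda>x. inverse (f x)) \<in> cont_fun X"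
  by (simp add: cont_fun_def continuous_map_atin tendsto_inverse)

lemma cont_fun_sum:
  "finite I \<Longrightarrow> (\<And>i. i \<in> I \<Longrightarrow> f i \<in> cont_fun X) \<Longrightarrow> (\<lambda>x. \<Sum>i\<in>I. f i x) \<in> cont_fun X"
  by (simp add: cont_fun_def continuous_map_sum)

lemma cont_fun_compose: "f \<in> cont_fun X \<Longrightarrow> continuous_map Z X \<pi> \<Longrightarrow> (\<lambda>z. f (\<pi> z)) \<in> cont_fun Z"
  using continuous_map_compose[of Z X \<pi> euclidean f] by (simp add: cont_fun_def o_def)

lemma cont_fun_cong:
  "f \<in> cont_fun X \<Longrightarrow> (\<And>x. x \<in> topspace X \<Longrightarrow> f x = g x) \<Longrightarrow> g \<in> cont_fun X"
  by (auto simp: cont_fun_def intro: continuous_map_eq)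

lemma cont_matI:
  assumes "\<And>x. x \<in> topspace X \<Longrightarrow> A x \<in> carrier_mat n n"
    and "\<And>i j. i < n \<Longrightarrow> j < n \<Longrightarrow> f i j \<in> cont_fun X"
    and "\<And>i j x. i < n \<Longrightarrow> j < n \<Longrightarrow> x \<in> topspace X \<Longrightarrow> f i j x = A x $$ (i, j)"
  shows "A \<in> cont_mat n X"
proof -
  have "(\<lambda>x. A x $$ (i, j)) \<in> cont_fun X" if "i < n" "j < n" for i j
    using cont_fun_cong[OF assms(2)[OF that] assms(3)[OF that]] .
  with assms(1) show ?thesis by (simp add: cont_mat_def)
qed

lemma cont_mat_carrier: "A \<in> cont_mat n X \<Longrightarrow> x \<in> topspace X \<Longrightarrow> A x \<in> carrier_mat n n"
  by (simp add: cont_mat_def)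

lemma cont_mat_entry:
  "A \<in> cont_mat n X \<Longrightarrow> i < n \<Longrightarrow> j < n \<Longrightarrow> (\<lambda>x. A x $$ (i, j)) \<in> cont_fun X"
  by (simp add: cont_mat_def)

lemma cont_mat_dim:
  assumes "A \<in> cont_mat n X" "x \<in> topspace X"
  shows "dim_row (A x) = n" "dim_col (A x) = n"
  using cont_mat_carrier[OF assms] by auto

lemma cont_mat_cong:
  assumes "A \<in> cont_mat n X" "\<And>x. x \<in> topspace X \<Longrightarrow> B x = A x"
  shows "B \<in> cont_mat n X"
  by (rule cont_matI[where f = "\<lambda>i j x. A x $$ (i, j)"])
    (simp_all add: assms cont_mat_entry[OF assms(1)] cont_mat_carrier[OF assms(1)])

lemma cont_mat_compose:
  assumes "A \<in> cont_mat n X" "continuous_map Z X \<pi>"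
  shows "(\<lambda>z. A (\<pi> z)) \<in> cont_mat n Z"
proof -
  have "A (\<pi> z) \<in> carrier_mat n n" if "z \<in> topspace Z" for z
    using that assms continuous_map_image_subset_topspace[OF assms(2)]
    by (auto intro: cont_mat_carrier)
  moreover have "(\<lambda>z. A (\<pi> z) $$ (i, j)) \<in> cont_fun Z" if "i < n" "j < n" for i j
    using cont_fun_compose[OF cont_mat_entry[OF assms(1) that] assms(2)] .
  ultimately show ?thesis by (simp add: cont_mat_def)
qed

lemma cont_mat_const: "C \<in> carrier_mat n n \<Longrightarrow> (\<lambda>_. C) \<in> cont_mat n X"
  by (simp add: cont_mat_def cont_fun_const)

lemma cont_mat_mat_diag:
  assumes "\<And>i. i < n \<Longrightarrow> d i \<in> cont_fun X"
  shows "(\<lambda>x. mat_diag n (\<lambda>i. d i x)) \<in> cont_mat n X"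
  by (rule cont_matI[where f = "\<lambda>i j. if i = j then d j else (\<lambda>_. 0)"])
    (simp_all add: assms cont_fun_const mat_diag_def)

lemma cont_mat_add:
  assumes "A \<in> cont_mat n X" "B \<in> cont_mat n X"
  shows "(\<lambda>x. A x + B x) \<in> cont_mat n X"
  by (rule cont_matI[where f = "\<lambda>i j x. A x $$ (i, j) + B x $$ (i, j)"])
    (simp_all add: assms cont_mat_dim[OF assms(1)] cont_mat_dim[OF assms(2)]
      cont_mat_carrier[OF assms(2)]
      cont_fun_add[OF cont_mat_entry[OF assms(1)] cont_mat_entry[OF assms(2)]])

lemma cont_mat_smult:
  assumes "c \<in> cont_fun X" "A \<in> cont_mat n X"
  shows "(\<lambda>x. c x \<cdot>\<^sub>m A x) \<in> cont_mat n X"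
  by (rule cont_matI[where f = "\<lambda>i j x. c x * A x $$ (i, j)"])
    (simp_all add: assms cont_mat_dim[OF assms(2)] cont_mat_carrier[OF assms(2)]
      cont_fun_mult[OF assms(1) cont_mat_entry[OF assms(2)]])

lemma cont_mat_mult:
  assumes "A \<in> cont_mat n X" "B \<in> cont_mat n X"
  shows "(\<lambda>x. A x * B x) \<in> cont_mat n X"
proof (rule cont_matI[where f = "\<lambda>i j x. \<Sum>k<n. A x $$ (i, k) * B x $$ (k, j)"])
  note [simp] = cont_mat_dim[OF assms(1)] cont_mat_dim[OF assms(2)]
  show "A x * B x \<in> carrier_mat n n" if "x \<in> topspace X" for x
    using assms[THEN cont_mat_carrier, OF that] by auto
  show "(\<lambda>x. \<Sum>k<n. A x $$ (i, k) * B x $$ (k, j)) \<in> cont_fun X" if "i < n" "j < n" for i j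
    using that assms by (intro cont_fun_sum cont_fun_mult cont_mat_entry) auto
  show "(\<Sum>k<n. A x $$ (i, k) * B x $$ (k, j)) = (A x * B x) $$ (i, j)"
    if "i < n" "j < n" "x \<in> topspace X" for i j x
    using that by (simp add: scalar_prod_def lessThan_atLeast0)
qed

lemma cont_mat_adjoint:
  assumes "A \<in> cont_mat n X"
  shows "(\<lambda>x. mat_adjoint (A x)) \<in> cont_mat n X"
  by (rule cont_matI[where f = "\<lambda>i j x. cnj (A x $$ (j, i))"])
    (simp_all add: assms cont_mat_dim[OF assms] cont_mat_carrier[OF assms] mat_adjoint_index
      cont_fun_cnj[OF cont_mat_entry[OF assms]])

lemma unitary_mat_iff:
  "U \<in> unitary_mat n X \<longleftrightarrow> U \<in> cont_mat n X \<and> (\<forall>x\<in>topspace X. unitary n (U x))"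
  by (auto simp: unitary_mat_def unitary_def cont_mat_carrier)

lemma unitary_equivI:
  assumes "A \<in> cont_mat n X" "B \<in> cont_mat n X" "U \<in> unitary_mat n X"
    and "\<And>x. x \<in> topspace X \<Longrightarrow> B x = mat_adjoint (U x) * A x * U x"
  shows "(A, B) \<in> unitary_equiv n X"
  using assms by (auto simp: unitary_equiv_def)

text \<open>
  Families that agree on the space are interchangeable; identities for transfers hold only there.
\<close>

lemma unitary_equiv_cong:
  assumes "(A, B) \<in> unitary_equiv n X"
    and "\<And>x. x \<in> topspace X \<Longrightarrow> A' x = A x" "\<And>x. x \<in> topspace X \<Longrightarrow> B' x = B x"
  shows "(A', B') \<in> unitary_equiv n X"
  using assms cont_mat_cong[of A n X A'] cont_mat_cong[of B n X B']
  by (auto simp: unitary_equiv_def)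

lemma equiv_unitary_equiv: "equiv (cont_mat n X) (unitary_equiv n X)"
proof (rule equivI)
  show "unitary_equiv n X \<subseteq> cont_mat n X \<times> cont_mat n X"
    by (auto simp: unitary_equiv_def)
  show "refl_on (cont_mat n X) (unitary_equiv n X)"
  proof (rule refl_onI)
    fix A assume A: "A \<in> cont_mat n X"
    show "(A, A) \<in> unitary_equiv n X"
      using A cont_mat_carrier[OF A]
      by (intro unitary_equivI[of _ _ _ _ "\<lambda>_. 1\<^sub>m n"])
        (auto simp: unitary_mat_iff unitary_one cont_mat_const square_mat_simps[where n = n])
  qed
  show "sym (unitary_equiv n X)"
  proof (rule symI)
    fix A B assume "(A, B) \<in> unitary_equiv n X"
    then obtain U where A: "A \<in> cont_mat n X" and B: "B \<in> cont_mat n X"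
      and U: "U \<in> cont_mat n X" "\<And>x. x \<in> topspace X \<Longrightarrow> unitary n (U x)"
      and BU: "\<And>x. x \<in> topspace X \<Longrightarrow> B x = mat_adjoint (U x) * A x * U x"
      by (auto simp: unitary_equiv_def unitary_mat_iff)
    show "(B, A) \<in> unitary_equiv n X"
    proof (rule unitary_equivI[OF B A])
      show "(\<lambda>x. mat_adjoint (U x)) \<in> unitary_mat n X"
        using U by (auto simp: unitary_mat_iff cont_mat_adjoint unitary_adjoint)
      fix x assume x: "x \<in> topspace X"
      note c = cont_mat_carrier[OF A x] cont_mat_carrier[OF U(1) x]
      have "mat_adjoint (mat_adjoint (U x)) * B x * mat_adjoint (U x) =
            (U x * mat_adjoint (U x)) * (A x * (U x * mat_adjoint (U x)))"
        using c by (simp add: BU[OF x] square_mat_simps[where n = n])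
      thus "A x = mat_adjoint (mat_adjoint (U x)) * B x * mat_adjoint (U x)"
        using c U(2)[OF x] by (simp add: unitary_def)
    qed
  qed
  show "trans (unitary_equiv n X)"
  proof (rule transI)
    fix A B C assume "(A, B) \<in> unitary_equiv n X" "(B, C) \<in> unitary_equiv n X"
    then obtain U V where A: "A \<in> cont_mat n X" and C: "C \<in> cont_mat n X"
      and U: "U \<in> cont_mat n X" "\<And>x. x \<in> topspace X \<Longrightarrow> unitary n (U x)"
      and V: "V \<in> cont_mat n X" "\<And>x. x \<in> topspace X \<Longrightarrow> unitary n (V x)"
      and BU: "\<And>x. x \<in> topspace X \<Longrightarrow> B x = mat_adjoint (U x) * A x * U x"
      and CV: "\<And>x. x \<in> topspace X \<Longrightarrow> C x = mat_adjoint (V x) * B x * V x"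
      by (auto simp: unitary_equiv_def unitary_mat_iff)
    show "(A, C) \<in> unitary_equiv n X"
    proof (rule unitary_equivI[OF A C])
      show "(\<lambda>x. U x * V x) \<in> unitary_mat n X"
        using U V by (auto simp: unitary_mat_iff cont_mat_mult unitary_mult)
      fix x assume x: "x \<in> topspace X"
      show "C x = mat_adjoint (U x * V x) * A x * (U x * V x)"
        using cont_mat_carrier[OF A x] cont_mat_carrier[OF U(1) x] cont_mat_carrier[OF V(1) x]
        by (simp add: BU[OF x] CV[OF x] square_mat_simps[where n = n])
    qed
  qed
qed

section \<open>Pulling back families of normal matrices\<close>

definition simple_roots :: "nat \<Rightarrow> 'a topology \<Rightarrow> (nat \<Rightarrow> 'a \<Rightarrow> complex) \<Rightarrow> bool" where
  "simple_roots n X l \<longleftrightarrow>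
     (\<forall>i<n. l i \<in> cont_fun X) \<and> (\<forall>x\<in>topspace X. inj_on (\<lambda>i. l i x) {..<n})"

text \<open>
  Only a pointwise diagonalisation is demanded, so \<open>W\<close> may depend discontinuously on \<open>x\<close>. A
  continuous choice exists only in the class of the diagonal family with entries \<open>l\<close>.
\<close>

definition normal_with_roots ::
  "nat \<Rightarrow> 'a topology \<Rightarrow> (nat \<Rightarrow> 'a \<Rightarrow> complex) \<Rightarrow> ('a \<Rightarrow> complex mat) set" where
  "normal_with_roots n X l =
     {A \<in> cont_mat n X. \<forall>x\<in>topspace X. \<exists>W. unitary n W \<and> A x = udiag n W (\<lambda>i. l i x)}"

text \<open>
  A polynomial with \<open>n\<close> linear factors has \<open>n\<close> distinct roots only if the factors are distinct.
\<close>

lemma admissible_poly_roots: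
  assumes "admissible_poly n X \<mu>"
  obtains l where "simple_roots n X l"
    and "\<forall>x\<in>topspace X. \<mu> x = (\<Prod>i<n. [:- l i x, 1:])"
proof -
  obtain l where l: "\<And>i. i < n \<Longrightarrow> l i \<in> cont_fun X"
    and \<mu>: "\<And>x. x \<in> topspace X \<Longrightarrow> \<mu> x = (\<Prod>i<n. [:- l i x, 1:])"
    using assms by (auto simp: admissible_poly_def splits_over_def)
  have "inj_on (\<lambda>i. l i x) {..<n}" if x: "x \<in> topspace X" for x
  proof (rule eq_card_imp_inj_on)
    have "{z. poly (\<mu> x) z = 0} = (\<lambda>i. l i x) ` {..<n}"
      by (auto simp: \<mu>[OF x] poly_prod)
    moreover have "card {z. poly (\<mu> x) z = 0} = n"
      using assms x by (simp add: admissible_poly_def multiplicity_free_def)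
    ultimately show "card ((\<lambda>i. l i x) ` {..<n}) = card {..<n}" by simp
  qed simp
  with l \<mu> show ?thesis by (intro that[of l]) (auto simp: simple_roots_def)
qed

lemma normal_mat_char_poly_eq:
  assumes l: "simple_roots n X l"
    and \<mu>: "\<forall>x\<in>topspace X. \<mu> x = (\<Prod>i<n. [:- l i x, 1:])"
  shows "{A \<in> normal_mat n X. \<forall>x\<in>topspace X. char_poly (A x) = \<mu> x} = normal_with_roots n X l"
proof -
  have pointwise: "(A x * mat_adjoint (A x) = mat_adjoint (A x) * A x \<and> char_poly (A x) = \<mu> x) \<longleftrightarrow>
        (\<exists>W. unitary n W \<and> A x = udiag n W (\<lambda>i. l i x))"
    if A: "A \<in> cont_mat n X" and x: "x \<in> topspace X" for A x
    using normal_unitarily_diagonalizable[OF cont_mat_carrier[OF A x], of "\<lambda>i. l i x"]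
      udiag_normal char_poly_udiag l x bspec[OF \<mu> x] unfolding simple_roots_def by metis
  show ?thesis
    unfolding normal_mat_def normal_with_roots_def using pointwise by blast
qed

text \<open>
  The pullback of \<open>A\<close> along \<open>\<pi>\<close>, with its eigenvalues \<open>l i (\<pi> z)\<close> replaced by \<open>r i z\<close> and its
  eigenvectors kept.
\<close>

definition transfer ::
  "nat \<Rightarrow> (nat \<Rightarrow> 'a \<Rightarrow> complex) \<Rightarrow> (nat \<Rightarrow> 'b \<Rightarrow> complex) \<Rightarrow> ('b \<Rightarrow> 'a) \<Rightarrow>
    ('a \<Rightarrow> complex mat) \<Rightarrow> 'b \<Rightarrow> complex mat" where
  "transfer n l r \<pi> A z = lagrange_calc n (\<lambda>i. l i (\<pi> z)) (\<lambda>i. r i z) (A (\<pi> z))"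

lemma transfer_udiag:
  assumes "simple_roots n X l" "\<pi> z \<in> topspace X" "unitary n W"
    and "A (\<pi> z) = udiag n W (\<lambda>i. l i (\<pi> z))"
  shows "transfer n l r \<pi> A z = udiag n W (\<lambda>i. r i z)"
  using assms by (simp add: transfer_def lagrange_calc_udiag simple_roots_def)

text \<open>
  The only division is by differences \<open>l i - l k\<close> with \<open>k \<noteq> i\<close>, which have no zeros because the
  roots are simple.
\<close>

lemma cont_mat_lagrange_calc:
  assumes l: "simple_roots n X l" and r: "\<And>i. i < n \<Longrightarrow> r i \<in> cont_fun X"
    and A: "A \<in> cont_mat n X"
  shows "(\<lambda>x. lagrange_calc n (\<lambda>i. l i x) (\<lambda>i. r i x) (A x)) \<in> cont_mat n X"
proof -
  have prod: "(\<lambda>x. lagrange_prod n (\<lambda>i. l i x) (A x) i m) \<in> cont_mat n X"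
    if "i < n" "m \<le> n" for i m
    using that(2)
  proof (induction m)
    case 0
    show ?case by (simp add: cont_mat_const)
  next
    case (Suc m)
    have "(\<lambda>x. inverse (l i x - l m x) \<cdot>\<^sub>m (A x + (- l m x) \<cdot>\<^sub>m 1\<^sub>m n)) \<in> cont_mat n X"
      if "m \<noteq> i"
    proof (intro cont_mat_smult cont_mat_add A cont_mat_const cont_fun_inverse cont_fun_diff cont_fun_minus)
      show "l i x - l m x \<noteq> 0" if "x \<in> topspace X" for x
        using l that \<open>m \<noteq> i\<close> \<open>i < n\<close> Suc.prems by (auto simp: simple_roots_def inj_on_def)
    qed (use l \<open>i < n\<close> Suc.prems in \<open>auto simp: simple_roots_def\<close>)
    thus ?case using Suc by (cases "m = i") (auto intro!: cont_mat_mult cont_mat_const)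
  qed
  have "(\<lambda>x. lagrange_sum n (\<lambda>i. l i x) (\<lambda>i. r i x) (A x) m) \<in> cont_mat n X" if "m \<le> n" for m
    using that
    by (induction m) (auto intro!: cont_mat_const cont_mat_add cont_mat_smult prod r)
  thus ?thesis by (simp add: lagrange_calc_def)
qed

lemma transfer_normal_with_roots:
  assumes l: "simple_roots n X l" and r: "simple_roots n Z r" and \<pi>: "continuous_map Z X \<pi>"
    and A: "A \<in> normal_with_roots n X l"
  shows "transfer n l r \<pi> A \<in> normal_with_roots n Z r"
proof -
  have \<pi>Z: "\<pi> z \<in> topspace X" if "z \<in> topspace Z" for z
    using continuous_map_image_subset_topspace[OF \<pi>] that by auto
  have "simple_roots n Z (\<lambda>i z. l i (\<pi> z))"
    using l \<pi>Z by (auto simp: simple_roots_def intro: cont_fun_compose[OF _ \<pi>])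
  moreover have "(\<lambda>z. A (\<pi> z)) \<in> cont_mat n Z"
    using A \<pi> by (auto simp: normal_with_roots_def intro: cont_mat_compose)
  ultimately have "transfer n l r \<pi> A \<in> cont_mat n Z"
    unfolding transfer_def[abs_def] using r
    by (intro cont_mat_lagrange_calc) (auto simp: simple_roots_def)
  moreover have "\<exists>W. unitary n W \<and> transfer n l r \<pi> A z = udiag n W (\<lambda>i. r i z)"
    if "z \<in> topspace Z" for z
    using A \<pi>Z[OF that] transfer_udiag[OF l, of \<pi> z] by (fastforce simp: normal_with_roots_def)
  ultimately show ?thesis by (auto simp: normal_with_roots_def)
qed

text \<open>
  A unitary \<open>U\<close> with \<open>B = U\<^sup>* A U\<close> matches the eigenvectors of \<open>B\<close> with those of \<open>A\<close> for the same
  eigenvalue, so the pullback of \<open>U\<close> still works after the eigenvalues have been replaced.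
\<close>

lemma transfer_unitary_equiv:
  assumes l: "simple_roots n X l" and r: "simple_roots n Z r" and \<pi>: "continuous_map Z X \<pi>"
    and A: "A \<in> normal_with_roots n X l" and B: "B \<in> normal_with_roots n X l"
    and AB: "(A, B) \<in> unitary_equiv n X"
  shows "(transfer n l r \<pi> A, transfer n l r \<pi> B) \<in> unitary_equiv n Z"
proof -
  have \<pi>Z: "\<pi> z \<in> topspace X" if "z \<in> topspace Z" for z
    using continuous_map_image_subset_topspace[OF \<pi>] that by auto
  obtain U where U: "U \<in> cont_mat n X" "\<And>x. x \<in> topspace X \<Longrightarrow> unitary n (U x)"
    and BU: "\<And>x. x \<in> topspace X \<Longrightarrow> B x = mat_adjoint (U x) * A x * U x"
    using AB by (auto simp: unitary_equiv_def unitary_mat_iff)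
  show ?thesis
  proof (rule unitary_equivI)
    show "transfer n l r \<pi> A \<in> cont_mat n Z" "transfer n l r \<pi> B \<in> cont_mat n Z"
      using transfer_normal_with_roots[OF l r \<pi>] A B by (auto simp: normal_with_roots_def)
    show "(\<lambda>z. U (\<pi> z)) \<in> unitary_mat n Z"
      using U \<pi>Z by (auto simp: unitary_mat_iff intro: cont_mat_compose[OF _ \<pi>])
    fix z assume z: "z \<in> topspace Z"
    obtain W where W: "unitary n W" "A (\<pi> z) = udiag n W (\<lambda>i. l i (\<pi> z))"
      using A \<pi>Z[OF z] by (auto simp: normal_with_roots_def)
    have Uz: "unitary n (U (\<pi> z))" using U \<pi>Z[OF z] by auto
    have "B (\<pi> z) = udiag n (mat_adjoint (U (\<pi> z)) * W) (\<lambda>i. l i (\<pi> z))"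
      using BU[OF \<pi>Z[OF z]] W Uz by (simp add: udiag_conj unitary_carrier)
    hence "transfer n l r \<pi> B z = udiag n (mat_adjoint (U (\<pi> z)) * W) (\<lambda>i. r i z)"
      using transfer_udiag[OF l, of \<pi> z] \<pi>Z[OF z] unitary_mult[OF unitary_adjoint[OF Uz] W(1)] by simp
    thus "transfer n l r \<pi> B z = mat_adjoint (U (\<pi> z)) * transfer n l r \<pi> A z * U (\<pi> z)"
      using transfer_udiag[OF l, of \<pi> z W A r] \<pi>Z[OF z] W Uz by (simp add: udiag_conj unitary_carrier)
  qed
qed

text \<open>
  All transfers keep an eigenbasis \<open>W\<close> of the original matrix, so the intermediate eigenvalues
  \<open>r\<close> leave no trace.
\<close>

lemma transfer_transfer:
  assumes l: "simple_roots n X l" and r: "simple_roots n Z r"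
    and A: "A \<in> normal_with_roots n X l"
    and "\<iota> y \<in> topspace Z" "\<pi> (\<iota> y) \<in> topspace X"
  shows "transfer n r s \<iota> (transfer n l r \<pi> A) y = transfer n l s (\<lambda>y. \<pi> (\<iota> y)) A y"
proof -
  obtain W where W: "unitary n W" "A (\<pi> (\<iota> y)) = udiag n W (\<lambda>i. l i (\<pi> (\<iota> y)))"
    using A assms(5) by (auto simp: normal_with_roots_def)
  show ?thesis
    using transfer_udiag[OF l, of \<pi> "\<iota> y" W A] transfer_udiag[OF l, of "\<lambda>y. \<pi> (\<iota> y)" y W A]
      transfer_udiag[OF r, of \<iota> y W "transfer n l r \<pi> A"] W assms by simp
qed

lemma transfer_id:
  assumes "simple_roots n X l" "A \<in> normal_with_roots n X l" "x \<in> topspace X"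
  shows "transfer n l l (\<lambda>x. x) A x = A x"
proof -
  obtain W where "unitary n W" "A x = udiag n W (\<lambda>i. l i x)"
    using assms by (auto simp: normal_with_roots_def)
  thus ?thesis using transfer_udiag[OF assms(1), of "\<lambda>x. x" x W A] assms by simp
qed

text \<open>
  A pullback along a constant map consists of copies of one normal matrix, and the unitary matrix that
  diagonalises it serves for every point \<open>z\<close>.
\<close>

lemma transfer_const:
  assumes l: "simple_roots n X l" and r: "simple_roots n Z r" and c: "c \<in> topspace X"
    and A: "A \<in> normal_with_roots n X l"
  shows "(transfer n l r (\<lambda>_. c) A, \<lambda>z. mat_diag n (\<lambda>i. r i z)) \<in> unitary_equiv n Z"
proof -
  obtain W where W: "unitary n W" "A c = udiag n W (\<lambda>i. l i c)"
    using A c by (auto simp: normal_with_roots_def)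
  show ?thesis
  proof (rule unitary_equivI)
    show "transfer n l r (\<lambda>_. c) A \<in> cont_mat n Z"
      using transfer_normal_with_roots[OF l r _ A, of "\<lambda>_. c"] c by (auto simp: normal_with_roots_def)
    show "(\<lambda>z. mat_diag n (\<lambda>i. r i z)) \<in> cont_mat n Z"
      using r by (auto simp: simple_roots_def intro: cont_mat_mat_diag)
    show "(\<lambda>_. W) \<in> unitary_mat n Z"
      using W by (simp add: unitary_mat_iff unitary_carrier cont_mat_const)
    fix z
    have "mat_adjoint W * udiag n W (\<lambda>i. r i z) * W = mat_diag n (\<lambda>i. r i z)"
      using W(1) unitary_carrier[OF W(1)]
      by (simp add: udiag_conj unitary_def) (simp add: udiag_def square_mat_simps[where n = n])
    thus "mat_diag n (\<lambda>i. r i z) = mat_adjoint W * transfer n l r (\<lambda>_. c) A z * W"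
      using transfer_udiag[OF l, of "\<lambda>_. c" z W A r] W c by simp
  qed
qed

section \<open>Counting classes\<close>

text \<open>
  Without the point \<open>b\<close> of the second summand the two injections have disjoint images, so they combine
  into one. For finite sets it does not matter which element of the sum is removed; for infinite
  sets removing one does not change the cardinality.
\<close>

lemma cminus1_csum_le:
  assumes f: "inj_on f S1" "f ` S1 \<subseteq> S" and g: "inj_on g S2" "g ` S2 \<subseteq> S"
    and meet: "\<And>s t. s \<in> S1 \<Longrightarrow> t \<in> S2 \<Longrightarrow> f s = g t \<Longrightarrow> t = b"
  shows "cminus1 ( |S1| +c |S2| ) \<le>o |S|"
proof -
  let ?T = "S1 <+> S2"
  have "inj_on (case_sum f g) (?T - {Inr b})"
  proof (rule inj_onI)
    fix u v
    assume u: "u \<in> ?T - {Inr b}" and v: "v \<in> ?T - {Inr b}"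
      and eq: "case_sum f g u = case_sum f g v"
    from u consider (Inl) s where "s \<in> S1" "u = Inl s" | (Inr) t where "t \<in> S2" "t \<noteq> b" "u = Inr t"
      by (elim DiffE PlusE) auto
    thus "u = v"
    proof cases
      case (Inl s)
      from v consider (Inl') s' where "s' \<in> S1" "v = Inl s'"
        | (Inr') t' where "t' \<in> S2" "t' \<noteq> b" "v = Inr t'"
        by (elim DiffE PlusE) auto
      thus ?thesis
      proof cases
        case Inl'
        thus ?thesis using Inl eq inj_onD[OF f(1), of s s'] by simp
      next
        case Inr'
        thus ?thesis using Inl eq meet[of s t'] by simp
      qed
    next
      case (Inr t)
      from v consider (Inl') s' where "s' \<in> S1" "v = Inl s'"
        | (Inr') t' where "t' \<in> S2" "t' \<noteq> b" "v = Inr t'"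
        by (elim DiffE PlusE) auto
      thus ?thesis
      proof cases
        case Inl'
        thus ?thesis using Inr eq meet[of s' t] by simp
      next
        case Inr'
        thus ?thesis using Inr eq inj_onD[OF g(1), of t t'] by simp
      qed
    qed
  qed
  moreover have "case_sum f g ` (?T - {Inr b}) \<subseteq> S"
    using f g by auto
  ultimately have le: "|?T - {Inr b}| \<le>o |S|"
    by (intro card_of_ordLeq[THEN iffD1] exI conjI)
  have T: "|S1| +c |S2| = |?T|" "Field |?T| = ?T"
    by (simp_all add: csum_def Field_card_of)
  show ?thesis
  proof (cases "finite ?T")
    case False
    then obtain h where "bij_betw h ?T (?T - {Inr b})"
      using infinite_imp_bij_betw[of ?T "Inr b"] by metis
    hence "|?T| =o |?T - {Inr b}|"
      using card_of_ordIso[of ?T "?T - {Inr b}"] by metis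
    hence "|?T| \<le>o |S|" using le by (rule ordIso_ordLeq_trans)
    thus ?thesis unfolding cminus1_def T using False by (simp only: if_False)
  next
    case True
    define a where "a = (SOME a. a \<in> ?T)"
    have "|?T - {a}| \<le>o |?T - {Inr b}|"
    proof (cases "?T = {}")
      case False
      hence "a \<in> ?T" unfolding a_def by (simp add: some_in_eq)
      hence "card (?T - {a}) \<le> card (?T - {Inr b})"
        using True by (simp add: card_Diff_singleton_if)
      thus ?thesis using True by (simp add: finite_card_of_iff_card2)
    next
      case True
      thus ?thesis by (intro card_of_mono1) blast
    qed
    hence "|?T - {a}| \<le>o |S|" using le by (rule ordLeq_transitive)
    thus ?thesis using True T by (simp add: cminus1_def a_def)
  qed
qed

text \<open>
  The map on classes is obtained by applying \<open>F\<close> to a chosen representative. It is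
  injective because \<open>F\<close> reflects the relations. The third property keeps the representative
  accessible, so that values of two such maps can be compared.
\<close>

lemma quotient_map_inj:
  assumes R: "equiv C R" and R': "equiv C' R'" and N: "N \<subseteq> C" and N': "N' \<subseteq> C'"
    and F: "\<And>A. A \<in> N \<Longrightarrow> F A \<in> N'"
    and inj: "\<And>A B. A \<in> N \<Longrightarrow> B \<in> N \<Longrightarrow> (F A, F B) \<in> R' \<Longrightarrow> (A, B) \<in> R"
  obtains f where "inj_on f (N // R)" "f ` (N // R) \<subseteq> N' // R'"
    "\<forall>c\<in>N // R. \<exists>A\<in>N. c = R `` {A} \<and> f c = R' `` {F A}"
proof -
  have "\<forall>c\<in>N // R. \<exists>A. A \<in> N \<and> c = R `` {A}" by (auto elim!: quotientE)
  then obtain rep where rep: "\<And>c. c \<in> N // R \<Longrightarrow> rep c \<in> N \<and> c = R `` {rep c}" by metis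
  show ?thesis
  proof (rule that[of "\<lambda>c. R' `` {F (rep c)}"])
    show "inj_on (\<lambda>c. R' `` {F (rep c)}) (N // R)"
    proof (rule inj_onI)
      fix c d assume cd: "c \<in> N // R" "d \<in> N // R" "R' `` {F (rep c)} = R' `` {F (rep d)}"
      hence "(F (rep c), F (rep d)) \<in> R'"
        using eq_equiv_class[OF _ R'] F rep N' by (meson subsetD)
      hence "(rep c, rep d) \<in> R" using inj rep cd by blast
      thus "c = d" using equiv_class_eq[OF R] rep cd by metis
    qed
    show "(\<lambda>c. R' `` {F (rep c)}) ` (N // R) \<subseteq> N' // R'"
      using rep F by (blast intro: quotientI)
    show "\<forall>c\<in>N // R. \<exists>A\<in>N. c = R `` {A} \<and> R' `` {F (rep c)} = R' `` {F A}"
      using rep by blast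
  qed
qed

theorem proposition3p4:
  fixes X :: "'a topology" and Y :: "'b topology" and n :: nat
    and \<mu> :: "'a \<Rightarrow> complex poly" and \<mu>' :: "'b \<Rightarrow> complex poly"
    and \<rho> :: "'a \<times> 'b \<Rightarrow> complex poly"
  assumes "connected_CW_complex X" and "connected_CW_complex Y"
    and "\<And>p. finitely_generated_group (homology_group p X)"
    and "\<And>p. finitely_generated_group (homology_group p Y)"
    and "admissible_poly n X \<mu>" and "admissible_poly n Y \<mu>'"
    and "admissible_poly n (prod_topology X Y) \<rho>"
  shows "cminus1 (nu n X \<mu> +c nu n Y \<mu>') \<le>o nu n (prod_topology X Y) \<rho>"
proof -
  let ?Z = "prod_topology X Y"
  obtain x0 y0 where x0: "x0 \<in> topspace X" and y0: "y0 \<in> topspace Y"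
    using assms(1,2) unfolding connected_CW_complex_def by blast
  obtain l where l: "simple_roots n X l"
    and l\<mu>: "\<forall>x\<in>topspace X. \<mu> x = (\<Prod>i<n. [:- l i x, 1:])"
    by (rule admissible_poly_roots[OF assms(5)])
  obtain m where m: "simple_roots n Y m"
    and m\<mu>: "\<forall>y\<in>topspace Y. \<mu>' y = (\<Prod>i<n. [:- m i y, 1:])"
    by (rule admissible_poly_roots[OF assms(6)])
  obtain r where r: "simple_roots n ?Z r"
    and r\<rho>: "\<forall>z\<in>topspace ?Z. \<rho> z = (\<Prod>i<n. [:- r i z, 1:])"
    by (rule admissible_poly_roots[OF assms(7)])
  let ?NX = "normal_with_roots n X l" and ?NY = "normal_with_roots n Y m"
    and ?NZ = "normal_with_roots n ?Z r"
  let ?RX = "unitary_equiv n X" and ?RY = "unitary_equiv n Y" and ?RZ = "unitary_equiv n ?Z"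
  have nu: "nu n X \<mu> = |?NX // ?RX|"
    "nu n Y \<mu>' = |?NY // ?RY|"
    "nu n ?Z \<rho> = |?NZ // ?RZ|"
    unfolding nu_def using normal_mat_char_poly_eq[OF l l\<mu>] normal_mat_char_poly_eq[OF m m\<mu>]
      normal_mat_char_poly_eq[OF r r\<rho>] by simp_all
  let ?F = "transfer n l r fst" and ?G = "transfer n m r snd"
  let ?i = "\<lambda>x. (x, y0)" and ?j = "\<lambda>y. (x0, y)"
  have i: "continuous_map X ?Z ?i" and j: "continuous_map Y ?Z ?j"
    using x0 y0 by (auto intro!: continuous_map_pairedI)
  have F: "?F A \<in> ?NZ" if "A \<in> ?NX" for A
    by (rule transfer_normal_with_roots[OF l r continuous_map_fst that])
  have G: "?G B \<in> ?NZ" if "B \<in> ?NY" for B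
    by (rule transfer_normal_with_roots[OF m r continuous_map_snd that])
  \<comment> \<open>Restricting to a slice undoes the transfer along one projection and turns the other into a
    transfer along a constant map.\<close>
  have iF: "transfer n r l ?i (?F A) x = A x"
    if "A \<in> ?NX" "x \<in> topspace X" for A x
    using transfer_transfer[OF l r that(1), of ?i x fst l] transfer_id[OF l that] that y0 by simp
  have jG: "transfer n r m ?j (?G B) y = B y"
    if "B \<in> ?NY" "y \<in> topspace Y" for B y
    using transfer_transfer[OF m r that(1), of ?j y snd m] transfer_id[OF m that] that x0 by simp
  have jF: "transfer n r m ?j (?F A) y = transfer n l m (\<lambda>_. x0) A y"
    if "A \<in> ?NX" "y \<in> topspace Y" for A y
    using transfer_transfer[OF l r that(1), of ?j y fst m] that x0 by simp
  have F_inj: "(A, B) \<in> ?RX"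
    if A: "A \<in> ?NX" and B: "B \<in> ?NX"
      and AB: "(?F A, ?F B) \<in> ?RZ" for A B
    using unitary_equiv_cong[OF transfer_unitary_equiv[OF r l i F[OF A] F[OF B] AB]]
      iF[OF A] iF[OF B] by simp
  have G_inj: "(A, B) \<in> ?RY"
    if A: "A \<in> ?NY" and B: "B \<in> ?NY"
      and AB: "(?G A, ?G B) \<in> ?RZ" for A B
    using unitary_equiv_cong[OF transfer_unitary_equiv[OF r m j G[OF A] G[OF B] AB]]
      jG[OF A] jG[OF B] by simp
  have meet: "(B, \<lambda>y. mat_diag n (\<lambda>i. m i y)) \<in> ?RY"
    if A: "A \<in> ?NX" and B: "B \<in> ?NY"
      and AB: "(?F A, ?G B) \<in> ?RZ" for A B
  proof -
    have "(transfer n l m (\<lambda>_. x0) A, B) \<in> ?RY"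
      using unitary_equiv_cong[OF transfer_unitary_equiv[OF r m j F[OF A] G[OF B] AB]]
        jF[OF A] jG[OF B] by simp
    thus ?thesis
      using transfer_const[OF l m x0 A] equiv_unitary_equiv[of n Y] by (meson equivE symE transE)
  qed
  have sub: "?NX \<subseteq> cont_mat n X" "?NY \<subseteq> cont_mat n Y" "?NZ \<subseteq> cont_mat n ?Z"
    by (auto simp: normal_with_roots_def)
  obtain f where f: "inj_on f (?NX // ?RX)"
    "f ` (?NX // ?RX) \<subseteq> ?NZ // ?RZ"
    "\<forall>c\<in>?NX // ?RX. \<exists>A\<in>?NX. c = ?RX `` {A} \<and> f c = ?RZ `` {?F A}"
    by (rule quotient_map_inj[OF equiv_unitary_equiv equiv_unitary_equiv sub(1,3) F F_inj])
  obtain g where g: "inj_on g (?NY // ?RY)"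
    "g ` (?NY // ?RY) \<subseteq> ?NZ // ?RZ"
    "\<forall>c\<in>?NY // ?RY. \<exists>B\<in>?NY. c = ?RY `` {B} \<and> g c = ?RZ `` {?G B}"
    by (rule quotient_map_inj[OF equiv_unitary_equiv equiv_unitary_equiv sub(2,3) G G_inj])
  show ?thesis
    unfolding nu
  proof (rule cminus1_csum_le[OF f(1,2) g(1,2)])
    fix s t assume s: "s \<in> ?NX // ?RX"
      and t: "t \<in> ?NY // ?RY" and st: "f s = g t"
    obtain A where A: "A \<in> ?NX" "f s = ?RZ `` {?F A}"
      using f(3) s by auto
    obtain B where B: "B \<in> ?NY" "t = ?RY `` {B}"
      "g t = ?RZ `` {?G B}"
      using g(3) t by auto
    have "(?F A, ?G B) \<in> ?RZ"
      using st A B G[OF B(1)] sub(3) eq_equiv_class[OF _ equiv_unitary_equiv, of n ?Z "?F A" "?G B"]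
      by auto
    from equiv_class_eq[OF equiv_unitary_equiv meet[OF A(1) B(1) this]]
    show "t = ?RY `` {\<lambda>y. mat_diag n (\<lambda>i. m i y)}" using B by simp
  qed
qed

end
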